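(* Let $p\ge 2$ be an integer, $\nu\in[0,1]$, let $\mathcal Z\subseteq\mathbb R^d$ be closed and convex, and let $F:\mathcal Z\to\mathbb R^d$. Suppose: (i) $F$ is monotone on $\mathcal Z$: $\langle F(\mathbf z)-F(\mathbf u),\mathbf z-\mathbf u\rangle\ge 0$ for all $\mathbf z,\mathbf u\in\mathcal Z$; (ii) $\mathcal Z$ is bounded: $D>0$ satisfies $\|\mathbf z-\mathbf u\|\le D$ for all $\mathbf z,\mathbf u\in\mathcal Z$; (iii) the derivative $\nabla^{p-1}F$ is Hölder continuous on $\mathcal Z$ with parameter $\nu$ and constant $\mathcal H_{p,\nu}$: $\|\nabla^{p-1}F(\mathbf z)-\nabla^{p-1}F(\mathbf u)\|\le \mathcal H_{p,\nu}\|\mathbf z-\mathbf u\|^{\nu}$ for all $\mathbf z,\mathbf u\in\mathcal Z$. Then the output $\bar{\mathbf z}_K$ of the $\nu$-regularized tensor extragradient method ($\nu$-RTEG) described in the context, run from $\mathbf z_0\in\mathcal Z$ for $K$ iterations, satisfies $$m(\bar{\mathbf z}_K)\le O\!\left(\frac{\mathcal H_{p,\nu}D^{p+\nu}}{K^{(p+\nu)/2}}\right).$$ Consequently, the method returns an $\epsilon$-weak solution using at most $$O\!\left(\mathcal H_{p,\nu}^{2/(p+\nu)}D^2\epsilon^{-2/(p+\nu)}\right)$$ tensor-oracle calls.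
   Context: $\|\cdot\|$ is the Euclidean norm on vectors and the induced spectral norm on linear maps. Weak gap: $m(\mathbf z)=\max_{\mathbf u\in\mathcal Z}\langle F(\mathbf u),\mathbf z-\mathbf u\rangle$. A point $\bar{\mathbf z}\in\mathcal Z$ is an $\epsilon$-weak solution if $m(\bar{\mathbf z})\le\epsilon$. For an operator $G:\mathcal Z\to\mathbb R^d$, $\mathrm{VI}_{\mathcal Z}(G)=\{\mathbf z^*\in\mathcal Z:\langle G(\mathbf z^* ),\mathbf z-\mathbf z^*\rangle\ge0\ \text{for all }\mathbf z\in\mathcal Z\}$. Taylor model: $\bar F_p(\mathbf u;\mathbf z)=\sum_{i=0}^{p-1}\frac1{i!}\nabla^iF(\mathbf z)[\mathbf u-\mathbf z]^i$. Regularized model for $H>0$: $\bar F_{p,\nu,H}(\mathbf u;\mathbf z)=\bar F_p(\mathbf u;\mathbf z)+H\|\mathbf u-\mathbf z\|^{p-2+\nu}(\mathbf u-\mathbf z)$. $T_p(\mathbf z;\nu,H)$ denotes a solution of the regularized model variational inequality: $T_p(\mathbf z;\nu,H)\in\mathrm{VI}_{\mathcal Z}(\bar F_{p,\nu,H}(\cdot;\mathbf z))$. Constant: $C_{p,\nu}=\frac1{(p-2)!}\int_0^1(1-t)^{p-2}t^\nu\,dt$. $\nu$-RTEG (input: $\mathbf z_0\in\mathcal Z$, $p\ge2$, $\nu\in[0,1]$, number of iterations $K$, and $\mathcal H_{p,\nu}$): set $M=2C_{p,\nu}\mathcal H_{p,\nu}$. For $k=0,\dots,K-1$: $\mathbf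 z_{k+1/2}=T_p(\mathbf z_k;\nu,M)$; $\gamma_k=M\|\mathbf z_{k+1/2}-\mathbf z_k\|^{p-2+\nu}$; $\mathbf z_{k+1}=\arg\min_{\mathbf z\in\mathcal Z}\{\langle F(\mathbf z_{k+1/2}),\mathbf z-\mathbf z_k\rangle+\frac{\gamma_k}2\|\mathbf z-\mathbf z_k\|^2\}$. Output: $\bar{\mathbf z}_K=\big(\sum_{k=0}^{K-1}\gamma_k^{-1}\mathbf z_{k+1/2}\big)/\big(\sum_{k=0}^{K-1}\gamma_k^{-1}\big)$. A tensor-oracle call is one computation of a point $T_p(\cdot;\cdot,\cdot)$, so each iteration uses one call. In the rate bound, $O(\cdot)$ hides a constant depending only on $p$ and $\nu$. *)

theory Defs
  imports "HOL-Analysis.Analysis"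
begin

definition weak_gap :: "('a::euclidean_space \<Rightarrow> 'a) \<Rightarrow> 'a set \<Rightarrow> 'a \<Rightarrow> real" where
  "weak_gap F Z z = (SUP u\<in>Z. F u \<bullet> (z - u))"

text \<open>The supremum is the maximum of the usual definition when \<open>Z\<close> is compact and \<open>F\<close>
  continuous.\<close>

lemma weak_gap_attained:
  assumes "compact Z" "Z \<noteq> {}" "continuous_on Z F"
  shows "\<exists>u\<in>Z. weak_gap F Z z = F u \<bullet> (z - u) \<and> (\<forall>x\<in>Z. F x \<bullet> (z - x) \<le> F u \<bullet> (z - u))"
proof -
  have "continuous_on Z (\<lambda>u. F u \<bullet> (z - u))"
    by (intro continuous_intros assms)
  then obtain u where u: "u \<in> Z" "\<forall>x\<in>Z. F x \<bullet> (z - x) \<le> F u \<bullet> (z - u)"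
    using continuous_attains_sup[OF assms(1,2)] by blast
  have "weak_gap F Z z = F u \<bullet> (z - u)"
    unfolding weak_gap_def by (rule cSup_eq_maximum) (use u in auto)
  with u show ?thesis by blast
qed

definition weak_solution :: "real \<Rightarrow> ('a::euclidean_space \<Rightarrow> 'a) \<Rightarrow> 'a set \<Rightarrow> 'a \<Rightarrow> bool" where
  "weak_solution \<epsilon> F Z z \<longleftrightarrow> z \<in> Z \<and> weak_gap F Z z \<le> \<epsilon>"

definition VI :: "'a::euclidean_space set \<Rightarrow> ('a \<Rightarrow> 'a) \<Rightarrow> 'a set" where
  "VI Z G = {z \<in> Z. \<forall>x\<in>Z. 0 \<le> G z \<bullet> (x - z)}"

definition monotone_operator_on :: "'a::euclidean_space set \<Rightarrow> ('a \<Rightarrow> 'a) \<Rightarrow> bool" where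
  "monotone_operator_on Z F \<longleftrightarrow> (\<forall>z\<in>Z. \<forall>u\<in>Z. 0 \<le> (F z - F u) \<bullet> (z - u))"

text \<open>\<open>0 powr 0 = 0\<close> in the library, whereas \<open>\<parallel>z - u\<parallel>\<close> to the power \<open>0\<close> is \<open>1\<close> even for \<open>z = u\<close>.\<close>

definition rpow :: "real \<Rightarrow> real \<Rightarrow> real" where
  "rpow x a = (if a = 0 then 1 else x powr a)"

text \<open>An \<open>n\<close>-linear map is a function on lists of which only the values on lists of length \<open>n\<close>
  matter.\<close>

definition multilinear :: "nat \<Rightarrow> ('a::euclidean_space list \<Rightarrow> 'a) \<Rightarrow> bool" where
  "multilinear n A \<longleftrightarrow> (\<forall>hs i. length hs = n \<longrightarrow> i < n \<longrightarrow> linear (\<lambda>h. A (hs[i := h])))"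

definition multilinear_norm :: "nat \<Rightarrow> ('a::euclidean_space list \<Rightarrow> 'a) \<Rightarrow> real" where
  "multilinear_norm n A = (SUP hs\<in>{hs. length hs = n \<and> (\<forall>h\<in>set hs. norm h \<le> 1)}. norm (A hs))"

text \<open>\<open>derivatives_on n Z F DF\<close>: the map \<open>F\<close> is \<open>n\<close> times differentiable on \<open>Z\<close>, and
  \<open>DF z [h\<^sub>1, \<dots>, h\<^sub>i]\<close> is the value of its \<open>i\<close>-th derivative at \<open>z\<close> on the vectors
  \<open>h\<^sub>1, \<dots>, h\<^sub>i\<close>, for all \<open>i \<le> n\<close>; the order of the derivative is the length of the list.
  Differentiating the values on fixed vectors is equivalent to differentiating the multilinear
  maps, because the dimension is finite.  Derivatives are taken within \<open>Z\<close>.  For convex \<open>Z\<close> with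
  nonempty interior they are unique; otherwise \<open>DF\<close> may be any choice of derivatives,
  for example those of a smooth extension of \<open>F\<close> to a neighbourhood of \<open>Z\<close>.\<close>

definition derivatives_on ::
  "nat \<Rightarrow> 'a::euclidean_space set \<Rightarrow> ('a \<Rightarrow> 'a) \<Rightarrow> ('a \<Rightarrow> 'a list \<Rightarrow> 'a) \<Rightarrow> bool" where
  "derivatives_on n Z F DF \<longleftrightarrow>
     (\<forall>z\<in>Z. DF z [] = F z) \<and>
     (\<forall>z\<in>Z. \<forall>i\<le>n. multilinear i (DF z)) \<and>
     (\<forall>z\<in>Z. \<forall>hs. length hs < n \<longrightarrow>
        ((\<lambda>x. DF x hs) has_derivative (\<lambda>h. DF z (h # hs))) (at z within Z))"

definition holder_derivative_on ::
  "nat \<Rightarrow> 'a::euclidean_space set \<Rightarrow> ('a \<Rightarrow> 'a list \<Rightarrow> 'a) \<Rightarrow> real \<Rightarrow> real \<Rightarrow> bool" where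
  "holder_derivative_on n Z DF \<nu> \<H> \<longleftrightarrow>
     (\<forall>z\<in>Z. \<forall>u\<in>Z. multilinear_norm n (\<lambda>hs. DF z hs - DF u hs) \<le> \<H> * rpow (norm (z - u)) \<nu>)"

definition taylor_model ::
  "nat \<Rightarrow> ('a::euclidean_space \<Rightarrow> 'a list \<Rightarrow> 'a) \<Rightarrow> 'a \<Rightarrow> 'a \<Rightarrow> 'a" where
  "taylor_model p DF z u = (\<Sum>i<p. (1 / fact i) *\<^sub>R DF z (replicate i (u - z)))"

definition regularized_model ::
  "nat \<Rightarrow> real \<Rightarrow> real \<Rightarrow> ('a::euclidean_space \<Rightarrow> 'a list \<Rightarrow> 'a) \<Rightarrow> 'a \<Rightarrow> 'a \<Rightarrow> 'a" where
  "regularized_model p \<nu> H DF z u =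
     taylor_model p DF z u + (H * rpow (norm (u - z)) (real p - 2 + \<nu>)) *\<^sub>R (u - z)"

definition C_const :: "nat \<Rightarrow> real \<Rightarrow> real" where
  "C_const p \<nu> = 1 / fact (p - 2) * integral {0..1} (\<lambda>t. (1 - t) ^ (p - 2) * t powr \<nu>)"

definition rteg_M :: "nat \<Rightarrow> real \<Rightarrow> real \<Rightarrow> real" where
  "rteg_M p \<nu> \<H> = 2 * C_const p \<nu> * \<H>"

definition rteg_gamma ::
  "nat \<Rightarrow> real \<Rightarrow> real \<Rightarrow> (nat \<Rightarrow> 'a::euclidean_space) \<Rightarrow> (nat \<Rightarrow> 'a) \<Rightarrow> nat \<Rightarrow> real" where
  "rteg_gamma p \<nu> \<H> z w k = rteg_M p \<nu> \<H> * rpow (norm (w k - z k)) (real p - 2 + \<nu>)"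

text \<open>\<open>rteg_run p \<nu> \<H> Z F DF z0 K z w\<close>: the sequences \<open>z k\<close> (for \<open>z\<^sub>k\<close>) and \<open>w k\<close> (for
  \<open>z\<^sub>k\<^sub>+\<^sub>1\<^sub>/\<^sub>2\<close>) arise from \<open>K\<close> iterations of the method started at \<open>z0\<close>.  The point \<open>w k\<close>
  is an arbitrary solution of the regularized model problem, the answer to the one tensor-oracle
  call of iteration \<open>k\<close>; a run of \<open>K\<close> iterations thus uses \<open>K\<close> calls.\<close>

definition rteg_run ::
  "nat \<Rightarrow> real \<Rightarrow> real \<Rightarrow> 'a::euclidean_space set \<Rightarrow> ('a \<Rightarrow> 'a) \<Rightarrow> ('a \<Rightarrow> 'a list \<Rightarrow> 'a) \<Rightarrow> 'a \<Rightarrow> nat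
     \<Rightarrow> (nat \<Rightarrow> 'a) \<Rightarrow> (nat \<Rightarrow> 'a) \<Rightarrow> bool" where
  "rteg_run p \<nu> \<H> Z F DF z0 K z w \<longleftrightarrow>
     z 0 = z0 \<and>
     (\<forall>k<K.
        w k \<in> VI Z (regularized_model p \<nu> (rteg_M p \<nu> \<H>) DF (z k)) \<and>
        is_arg_min
          (\<lambda>x. F (w k) \<bullet> (x - z k) + rteg_gamma p \<nu> \<H> z w k / 2 * (norm (x - z k))\<^sup>2)
          (\<lambda>x. x \<in> Z) (z (Suc k)))"

text \<open>The weighted average is undefined when some \<open>\<gamma>\<^sub>k\<close> vanishes.  Then the model at \<open>w k\<close> has no
  regularization term: either \<open>w k = z k\<close>, or \<open>\<H> = 0\<close> and the Taylor model is exact.  The point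
  \<open>w k\<close> is then taken as the output, in agreement with its infinite weight \<open>1 / \<gamma>\<^sub>k\<close>.\<close>

definition rteg_output ::
  "nat \<Rightarrow> real \<Rightarrow> real \<Rightarrow> nat \<Rightarrow> (nat \<Rightarrow> 'a::euclidean_space) \<Rightarrow> (nat \<Rightarrow> 'a) \<Rightarrow> 'a" where
  "rteg_output p \<nu> \<H> K z w =
     (let \<gamma> = rteg_gamma p \<nu> \<H> z w in
      if \<exists>k<K. \<gamma> k = 0 then w (LEAST k. \<gamma> k = 0)
      else (1 / (\<Sum>k<K. 1 / \<gamma> k)) *\<^sub>R (\<Sum>k<K. (1 / \<gamma> k) *\<^sub>R w k))"

text \<open>An explicit value for the constant hidden in the \<open>O\<close>-bound.  The constant must not depend on
  the dimension; an existential quantifier in a theorem about a type \<open>'a\<close> would let it depend on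
  \<open>'a\<close>, hence on the dimension.  The factor \<open>4 / 3\<close> comes from the estimate
  \<open>(\<Sum>k<K. (norm (w k - z k))\<^sup>2) \<le> 4 / 3 * D\<^sup>2\<close>.\<close>

definition rate_const :: "nat \<Rightarrow> real \<Rightarrow> real" where
  "rate_const p \<nu> = C_const p \<nu> * (4 / 3) powr ((real p - 2 + \<nu>) / 2)"

definition calls_const :: "nat \<Rightarrow> real \<Rightarrow> real" where
  "calls_const p \<nu> = rate_const p \<nu> powr (2 / (real p + \<nu>))"

end

theory Submission
  imports Defs
begin

text \<open>By Taylor's theorem the model at \<open>z\<^sub>k\<close> misses \<open>F\<close> at \<open>w\<^sub>k\<close> by at most
  \<open>\<gamma>\<^sub>k / 2 * norm (w\<^sub>k - z\<^sub>k)\<close>, so one step satisfies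
  \<open>F w\<^sub>k \<bullet> (w\<^sub>k - x) \<le> \<gamma>\<^sub>k / 2 * ((norm (x - z\<^sub>k))\<^sup>2 - (norm (x - z\<^sub>k\<^sub>+\<^sub>1))\<^sup>2 - 3 / 4 * (norm (w\<^sub>k - z\<^sub>k))\<^sup>2)\<close>.
  Dividing by \<open>\<gamma>\<^sub>k\<close>, telescoping and using monotonicity bounds the gap by
  \<open>D\<^sup>2 / (2 * (\<Sum>k. 1 / \<gamma>\<^sub>k))\<close> and also yields \<open>(\<Sum>k. (norm (w\<^sub>k - z\<^sub>k))\<^sup>2) \<le> 4 / 3 * D\<^sup>2\<close>; by the power
  mean inequality the latter makes \<open>\<Sum>k. 1 / \<gamma>\<^sub>k\<close> large.\<close>

section \<open>Multilinear maps on lists and their operator norm\<close>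

lemma multilinear_Cons:
  assumes "multilinear (Suc n) A"
  shows "multilinear n (\<lambda>hs. A (h # hs))"
  unfolding multilinear_def
proof (intro allI impI)
  fix hs :: "'a list" and i
  assume "length hs = n" "i < n"
  with assms have "linear (\<lambda>x. A ((h # hs)[Suc i := x]))"
    unfolding multilinear_def by (metis Suc_less_eq length_Cons)
  then show "linear (\<lambda>x. A (h # hs[i := x]))"
    by simp
qed

lemma multilinear_linear_hd:
  assumes "multilinear (Suc n) A" "length hs = n"
  shows "linear (\<lambda>h. A (h # hs))"
proof -
  have "linear (\<lambda>h. A ((0 # hs)[0 := h]))"
    using assms unfolding multilinear_def by (metis length_Cons zero_less_Suc)
  then show ?thesis
    by simp
qed

lemma multilinear_diff:
  assumes "multilinear n A" "multilinear n B"
  shows "multilinear n (\<lambda>hs. A hs - B hs)"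
  using assms unfolding multilinear_def by (auto intro: linear_compose_sub)

text \<open>Makes the supremum in \<open>multilinear_norm\<close> one over a bounded set. Expanding
  the first argument in \<open>Basis\<close> gives coefficients of absolute value at most 1, so the
  bounds for the curried maps add up.\<close>

lemma multilinear_bounded:
  assumes "multilinear n (A :: 'a::euclidean_space list \<Rightarrow> 'a)"
  shows "\<exists>B\<ge>0. \<forall>hs. length hs = n \<longrightarrow> (\<forall>h\<in>set hs. norm h \<le> 1) \<longrightarrow> norm (A hs) \<le> B"
  using assms
proof (induction n arbitrary: A)
  case 0
  show ?case
    by (rule exI[of _ "norm (A [])"]) simp
next
  case (Suc n)
  have "\<forall>b. \<exists>B\<ge>0. \<forall>hs. length hs = n \<longrightarrow> (\<forall>h\<in>set hs. norm h \<le> 1) \<longrightarrow> norm (A (b # hs)) \<le> B"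
    using Suc.IH[OF multilinear_Cons[OF Suc.prems]] by blast
  then obtain B where B: "\<And>b. 0 \<le> B b"
    "\<And>b hs. length hs = n \<Longrightarrow> (\<forall>h\<in>set hs. norm h \<le> 1) \<Longrightarrow> norm (A (b # hs)) \<le> B b"
    by metis
  show ?case
  proof (intro exI[of _ "\<Sum>b\<in>Basis. B b"] conjI allI impI)
    show "0 \<le> (\<Sum>b\<in>Basis. B b)"
      by (intro sum_nonneg B)
    fix hs :: "'a list"
    assume len: "length hs = Suc n" and le1: "\<forall>h\<in>set hs. norm h \<le> 1"
    then obtain h ks where hs: "hs = h # ks" "length ks = n"
      by (metis length_Suc_conv)
    interpret linear "\<lambda>h. A (h # ks)"
      using multilinear_linear_hd[OF Suc.prems hs(2)] .
    have "A hs = A ((\<Sum>b\<in>Basis. (h \<bullet> b) *\<^sub>R b) # ks)"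
      by (simp add: hs euclidean_representation)
    also have "\<dots> = (\<Sum>b\<in>Basis. (h \<bullet> b) *\<^sub>R A (b # ks))"
      by (simp add: sum scale)
    also have "norm \<dots> \<le> (\<Sum>b\<in>Basis. B b)"
    proof (rule sum_norm_le)
      fix b :: 'a assume "b \<in> Basis"
      then have "\<bar>h \<bullet> b\<bar> \<le> 1"
        using le1 hs Basis_le_norm[of b h] by auto
      moreover have "norm (A (b # ks)) \<le> B b"
        using B(2) hs le1 by auto
      ultimately show "norm ((h \<bullet> b) *\<^sub>R A (b # ks)) \<le> B b"
        using mult_mono[of "\<bar>h \<bullet> b\<bar>" 1 "norm (A (b # ks))" "B b"] by simp
    qed
    finally show "norm (A hs) \<le> (\<Sum>b\<in>Basis. B b)" .
  qed
qed

lemma norm_le_multilinear_norm: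
  assumes "multilinear n A" "length hs = n" "\<forall>h\<in>set hs. norm h \<le> 1"
  shows "norm (A hs) \<le> multilinear_norm n A"
  unfolding multilinear_norm_def
proof (rule cSUP_upper)
  show "bdd_above ((\<lambda>hs. norm (A hs)) ` {hs. length hs = n \<and> (\<forall>h\<in>set hs. norm h \<le> 1)})"
    using multilinear_bounded[OF assms(1)] by (auto simp: bdd_above_def)
qed (use assms in auto)

lemma multilinear_replicate_scaleR:
  assumes "multilinear n A"
  shows "A (replicate n (c *\<^sub>R h)) = c ^ n *\<^sub>R A (replicate n h)"
  using assms
proof (induction n arbitrary: A)
  case (Suc n)
  have "A (replicate (Suc n) (c *\<^sub>R h)) = c ^ n *\<^sub>R A ((c *\<^sub>R h) # replicate n h)"
    using Suc.IH[OF multilinear_Cons[OF Suc.prems]] by simp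
  also have "A ((c *\<^sub>R h) # replicate n h) = c *\<^sub>R A (h # replicate n h)"
    using linear_scale[OF multilinear_linear_hd[OF Suc.prems, of "replicate n h"]] by simp
  finally show ?case
    by (simp add: mult.commute)
qed simp

text \<open>By homogeneity it suffices to evaluate at \<open>sgn h\<close>, which lies in the unit
  ball even for \<open>h = 0\<close>.\<close>

lemma norm_multilinear_replicate_le:
  assumes "multilinear n A"
  shows "norm (A (replicate n h)) \<le> multilinear_norm n A * norm h ^ n"
proof -
  have "norm (A (replicate n (sgn h))) \<le> multilinear_norm n A"
    by (rule norm_le_multilinear_norm[OF assms]) (auto simp: norm_sgn)
  then have "norm h ^ n * norm (A (replicate n (sgn h))) \<le> norm h ^ n * multilinear_norm n A"
    by (intro mult_left_mono) auto
  moreover have "A (replicate n h) = norm h ^ n *\<^sub>R A (replicate n (sgn h))"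
    using multilinear_replicate_scaleR[OF assms, of "norm h" "sgn h"]
    by (cases "h = 0") (simp_all add: sgn_div_norm)
  ultimately show ?thesis
    by (simp add: mult.commute)
qed

section \<open>The constant \<open>C_const\<close> and the Taylor remainder\<close>

lemma C_const_integrand_integrable:
  assumes "0 \<le> \<nu>"
  shows "(\<lambda>t::real. (1 - t) ^ n * t powr \<nu>) integrable_on {0..1}"
proof (cases "\<nu> = 0")
  case True
  \<comment> \<open>Since \<open>0 powr 0 = 0\<close>, the integrand jumps at \<open>t = 0\<close>;
    it differs from this polynomial at that point only.\<close>
  have "(\<lambda>t::real. (1 - t) ^ n) integrable_on {0..1}"
    by (intro integrable_continuous_real continuous_intros)
  then show ?thesis
    by (rule integrable_spike_finite[of "{0}", rotated 2]) (auto simp: True)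
next
  case False
  with assms show ?thesis
    by (intro integrable_continuous_real continuous_intros continuous_on_powr') auto
qed

lemma C_const_nonneg:
  assumes "0 \<le> \<nu>"
  shows "0 \<le> C_const p \<nu>"
  unfolding C_const_def
  by (intro mult_nonneg_nonneg integral_nonneg C_const_integrand_integrable assms) auto

lemma rpow_nonneg: "0 \<le> rpow x a"
  by (simp add: rpow_def)

lemma rpow_mult:
  assumes "0 \<le> x" "0 \<le> y"
  shows "rpow (x * y) a = rpow x a * rpow y a"
  using assms by (simp add: rpow_def powr_mult)

lemma has_integral_taylor_weight:
  assumes "0 < n"
  shows "((\<lambda>x::real. (1 - x) ^ (n - 1) / fact (n - 1)) has_integral (1 / fact n)) {0..1}"
proof -
  obtain m where n: "n = Suc m"
    using assms gr0_implies_Suc by blast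
  have "((\<lambda>x::real. (1 - x) ^ m / fact m) has_integral
      - ((1 - 1) ^ Suc m / fact (Suc m)) - - ((1 - 0) ^ Suc m / fact (Suc m))) {0..1}"
  proof (rule fundamental_theorem_of_calculus)
    fix x :: real
    have "((\<lambda>x. - ((1 - x) ^ Suc m / fact (Suc m))) has_field_derivative (1 - x) ^ m / fact m) (at x within {0..1})"
      by (rule derivative_eq_intros refl | simp add: divide_simps)+
    then show "((\<lambda>x. - ((1 - x) ^ Suc m / fact (Suc m))) has_vector_derivative (1 - x) ^ m / fact m) (at x within {0..1})"
      by (simp add: has_real_derivative_iff_has_vector_derivative)
  qed simp
  then show ?thesis
    by (simp add: n)
qed

text \<open>Taylor's formula along the segment from \<open>z\<close> to \<open>u\<close>, with
  remainder of order \<open>p - 1\<close>, puts the highest available derivative under the integral.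
  The last term of the model is the same integral with that derivative frozen at \<open>z\<close>.
  Only the difference of the two derivatives remains; the Holder condition bounds it by a multiple
  of \<open>x powr \<nu>\<close>, whose weighted integral is \<open>C_const\<close>.\<close>

lemma taylor_model_error:
  assumes p: "2 \<le> p" and \<nu>: "0 \<le> \<nu>" and "convex Z"
    and der: "derivatives_on (p - 1) Z F DF"
    and hold: "holder_derivative_on (p - 1) Z DF \<nu> \<H>"
    and zZ: "z \<in> Z" and uZ: "u \<in> Z"
  shows "norm (F u - taylor_model p DF z u)
    \<le> C_const p \<nu> * \<H> * rpow (norm (u - z)) (real p - 2 + \<nu>) * norm (u - z)"
proof -
  define n where "n = p - 1"
  have n: "0 < n" "p = Suc n" "p - 2 = n - 1"
    using p by (auto simp: n_def)
  define h where "h = u - z"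
  define \<phi> where "\<phi> m t = DF (z + t *\<^sub>R h) (replicate m h)" for m and t :: real
  have inZ: "z + t *\<^sub>R h \<in> Z" if "t \<in> {0..1}" for t
    using convexD_alt[OF assms(3) zZ uZ, of t] that by (simp add: h_def algebra_simps)
  have D: "(\<phi> m has_vector_derivative \<phi> (Suc m) t) (at t within {0..1})"
    if m: "m < n" and t: "0 \<le> t" "t \<le> 1" for m t
  proof -
    have affine: "((\<lambda>s. z + s *\<^sub>R h) has_derivative (\<lambda>s. s *\<^sub>R h)) (at t within {0..1})"
      by (auto intro!: derivative_eq_intros)
    \<comment> \<open>The chain rule works with derivatives within \<open>Z\<close> because the
      whole segment lies in \<open>Z\<close>.\<close>
    have "(\<phi> m has_derivative (\<lambda>s. DF (z + t *\<^sub>R h) ((s *\<^sub>R h) # replicate m h))) (at t within {0..1})"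
      unfolding \<phi>_def
      by (rule has_derivative_in_compose2[OF _ _ _ affine, where t = Z
            and g = "\<lambda>x. DF x (replicate m h)" and g' = "\<lambda>x k. DF x (k # replicate m h)"])
        (use der inZ m t in \<open>auto simp: derivatives_on_def n_def\<close>)
    moreover have "multilinear (Suc m) (DF (z + t *\<^sub>R h))"
      using der inZ[of t] m t unfolding derivatives_on_def n_def by auto
    from linear_scale[OF multilinear_linear_hd[OF this, of "replicate m h"]]
    have "DF (z + t *\<^sub>R h) ((s *\<^sub>R h) # replicate m h) = s *\<^sub>R \<phi> (Suc m) t" for s
      by (simp add: \<phi>_def)
    ultimately show ?thesis
      by (simp add: has_vector_derivative_def)
  qed
  let ?w = "\<lambda>x::real. (1 - x) ^ (n - 1) / fact (n - 1)"
  have "((\<lambda>x. ?w x *\<^sub>R \<phi> n x) has_integral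
      \<phi> 0 1 - (\<Sum>i<n. ((1 - 0) ^ i / fact i) *\<^sub>R \<phi> i 0)) {0..1}"
    by (rule Taylor_has_integral) (use D n in auto)
  moreover have "((\<lambda>x. ?w x *\<^sub>R \<phi> n 0) has_integral (1 / fact n) *\<^sub>R \<phi> n 0) {0..1}"
    by (rule has_integral_scaleR_left has_integral_taylor_weight n)+
  ultimately have "((\<lambda>x. ?w x *\<^sub>R \<phi> n x - ?w x *\<^sub>R \<phi> n 0) has_integral
      \<phi> 0 1 - (\<Sum>i<n. ((1 - 0) ^ i / fact i) *\<^sub>R \<phi> i 0) - (1 / fact n) *\<^sub>R \<phi> n 0) {0..1}"
    by (rule has_integral_diff)
  moreover have "\<phi> 0 1 = F u"
    using der uZ by (simp add: \<phi>_def h_def derivatives_on_def)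
  moreover have "taylor_model p DF z u = (\<Sum>i<n. ((1 - 0) ^ i / fact i) *\<^sub>R \<phi> i 0) + (1 / fact n) *\<^sub>R \<phi> n 0"
    by (simp add: taylor_model_def \<phi>_def h_def n(2))
  ultimately have int: "((\<lambda>x. ?w x *\<^sub>R (\<phi> n x - \<phi> n 0)) has_integral
      F u - taylor_model p DF z u) {0..1}"
    by (simp add: scaleR_diff_right diff_diff_eq)
  define c where "c = \<H> * rpow (norm h) \<nu> * norm h ^ n"
  have bound: "norm (?w x *\<^sub>R (\<phi> n x - \<phi> n 0)) \<le> c / fact (n - 1) * ((1 - x) ^ (n - 1) * x powr \<nu>)"
    if x: "x \<in> {0..1}" for x
  \<comment> \<open>At \<open>x = 0\<close> the left side vanishes. This case is separate because
    \<open>rpow\<close> and \<open>powr\<close> disagree there when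
    \<open>\<nu> = 0\<close>.\<close>
  proof (cases "x = 0")
    case False
    have "norm (\<phi> n x - \<phi> n 0) \<le> multilinear_norm n (\<lambda>hs. DF (z + x *\<^sub>R h) hs - DF z hs) * norm h ^ n"
      unfolding \<phi>_def
      using norm_multilinear_replicate_le[OF multilinear_diff, of n "DF (z + x *\<^sub>R h)" "DF z" h]
        der inZ[OF x] zZ unfolding derivatives_on_def n_def by simp
    also have "\<dots> \<le> \<H> * rpow (norm (x *\<^sub>R h)) \<nu> * norm h ^ n"
      using hold inZ[OF x] zZ unfolding holder_derivative_on_def n_def
      by (intro mult_right_mono) (force, simp)
    also have "\<dots> = c * x powr \<nu>"
      using x False by (simp add: c_def rpow_mult) (simp add: rpow_def)
    finally have "?w x * norm (\<phi> n x - \<phi> n 0) \<le> ?w x * (c * x powr \<nu>)"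
      using x by (intro mult_left_mono) auto
    then show ?thesis
      using x by (simp add: mult_ac)
  qed simp
  have "norm (F u - taylor_model p DF z u)
      \<le> integral {0..1} (\<lambda>x. c / fact (n - 1) * ((1 - x) ^ (n - 1) * x powr \<nu>))"
    unfolding integral_unique[OF int, symmetric]
    by (intro integral_norm_bound_integral bound has_integral_integrable[OF int]
        integrable_on_mult_right C_const_integrand_integrable \<nu>)
  also have "\<dots> = C_const p \<nu> * c"
    by (simp add: C_const_def n(3))
  \<comment> \<open>Of the \<open>n = p - 1\<close> factors \<open>norm h\<close>, all but one go
    into the exponent of the regularizer.\<close>
  also have "rpow (norm h) \<nu> * norm h ^ n = rpow (norm h) (real p - 2 + \<nu>) * norm h"
  proof (cases "h = 0")
    case False
    then have "norm h ^ (n - 1) = norm h powr real (n - 1)"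
      by (simp add: powr_realpow)
    moreover have "real (n - 1) = real p - 2"
      using p by (simp add: n_def)
    moreover have "norm h ^ n = norm h ^ (n - 1) * norm h"
      using n(1) by (metis Suc_diff_1 power_Suc2)
    moreover have "rpow (norm h) b = norm h powr b" for b
      using False by (simp add: rpow_def)
    ultimately show ?thesis
      by (simp add: powr_add)
  qed (use n in \<open>simp add: rpow_def\<close>)
  then have "C_const p \<nu> * c = C_const p \<nu> * \<H> * rpow (norm h) (real p - 2 + \<nu>) * norm h"
    by (simp add: c_def)
  finally show ?thesis
    by (simp add: h_def)
qed

section \<open>One step of the extragradient method\<close>

text \<open>Completing the square shows that \<open>y\<close> is the projection onto
  \<open>Z\<close> of the unconstrained minimizer \<open>a\<close>. The obtuse angle property of
  projections, rewritten by the polarization identity, gives the bound.\<close>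

lemma prox_step:
  fixes Z :: "'a::euclidean_space set"
  assumes Z: "convex Z" "closed Z" and "0 < \<gamma>"
    and min: "is_arg_min (\<lambda>x. g \<bullet> (x - z) + \<gamma> / 2 * (norm (x - z))\<^sup>2) (\<lambda>x. x \<in> Z) y"
    and "x \<in> Z"
  shows "g \<bullet> (y - x) \<le> \<gamma> / 2 * ((norm (x - z))\<^sup>2 - (norm (x - y))\<^sup>2 - (norm (y - z))\<^sup>2)"
proof -
  define a where "a = z - (1 / \<gamma>) *\<^sub>R g"
  have sq: "\<gamma> / 2 * (norm (v - a))\<^sup>2
      = (g \<bullet> (v - z) + \<gamma> / 2 * (norm (v - z))\<^sup>2) + (norm g)\<^sup>2 / (2 * \<gamma>)" for v
  proof -
    have "v - a = (v - z) + (1 / \<gamma>) *\<^sub>R g"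
      by (simp add: a_def)
    then have "(norm (v - a))\<^sup>2 = (norm (v - z))\<^sup>2 + 2 / \<gamma> * (g \<bullet> (v - z)) + (norm g)\<^sup>2 / \<gamma>\<^sup>2"
      by (simp only: power2_norm_eq_inner)
        (simp add: inner_add_left inner_add_right inner_commute power2_eq_square)
    then show ?thesis
      using \<open>0 < \<gamma>\<close> by (simp add: field_simps power2_eq_square)
  qed
  have "dist a y \<le> dist a v" if "v \<in> Z" for v
  proof -
    have "\<gamma> / 2 * (norm (y - a))\<^sup>2 \<le> \<gamma> / 2 * (norm (v - a))\<^sup>2"
      using min that unfolding sq is_arg_min_def by (simp add: not_less)
    then have "(norm (y - a))\<^sup>2 \<le> (norm (v - a))\<^sup>2"
      using \<open>0 < \<gamma>\<close> by simp
    then show ?thesis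
      by (simp add: dist_norm norm_minus_commute)
  qed
  then have "(a - y) \<bullet> (x - y) \<le> 0"
    using min \<open>x \<in> Z\<close> by (intro any_closest_point_dot[OF Z]) (auto simp: is_arg_min_def)
  then have "\<gamma> * ((a - y) \<bullet> (x - y)) \<le> 0"
    using \<open>0 < \<gamma>\<close> by (simp add: mult_le_0_iff)
  also have "\<gamma> * ((a - y) \<bullet> (x - y)) = \<gamma> * ((z - y) \<bullet> (x - y)) + g \<bullet> (y - x)"
    using \<open>0 < \<gamma>\<close> by (simp add: a_def inner_diff_left inner_diff_right right_diff_distrib)
  finally have "g \<bullet> (y - x) \<le> \<gamma> * ((y - z) \<bullet> (x - y))"
    by (simp add: inner_diff_left right_diff_distrib)
  also have "(y - z) \<bullet> (x - y) = ((norm (x - z))\<^sup>2 - (norm (x - y))\<^sup>2 - (norm (y - z))\<^sup>2) / 2"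
    by (simp add: power2_norm_eq_inner inner_diff_left inner_diff_right inner_commute)
  finally show ?thesis
    by simp
qed

text \<open>\<open>g \<bullet> (w - x)\<close> splits into a proximal term at \<open>y\<close>, the
  model inequality tested at \<open>y\<close>, and the model error \<open>g - t\<close>. The squares
  of \<open>norm (y - z)\<close> cancel between the first two.\<close>

lemma extragradient_step:
  fixes g t w x y z :: "'a::euclidean_space"
  assumes "0 \<le> \<gamma>"
    and prox: "g \<bullet> (y - x) \<le> \<gamma> / 2 * ((norm (x - z))\<^sup>2 - (norm (x - y))\<^sup>2 - (norm (y - z))\<^sup>2)"
    and model: "0 \<le> (t + \<gamma> *\<^sub>R (w - z)) \<bullet> (y - w)"
    and err: "norm (g - t) \<le> \<gamma> / 2 * norm (w - z)"
  shows "g \<bullet> (w - x)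
    \<le> \<gamma> / 2 * ((norm (x - z))\<^sup>2 - (norm (x - y))\<^sup>2 - 3 / 4 * (norm (w - z))\<^sup>2)"
proof -
  define r s where "r = norm (w - z)" and "s = norm (w - y)"
  have "t \<bullet> (w - y) \<le> \<gamma> * ((w - z) \<bullet> (y - w))"
    using model by (simp add: inner_add_left inner_diff_right right_diff_distrib)
  also have "(w - z) \<bullet> (y - w) = ((norm (y - z))\<^sup>2 - r\<^sup>2 - s\<^sup>2) / 2"
    unfolding r_def s_def
    by (simp add: power2_norm_eq_inner inner_diff_left inner_diff_right inner_commute)
  finally have "t \<bullet> (w - y) \<le> \<gamma> / 2 * ((norm (y - z))\<^sup>2 - r\<^sup>2 - s\<^sup>2)"
    by simp
  moreover have "(g - t) \<bullet> (w - y) \<le> \<gamma> / 2 * (r * s)"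
  proof -
    have "(g - t) \<bullet> (w - y) \<le> norm (g - t) * s"
      unfolding s_def by (rule norm_cauchy_schwarz)
    also have "\<dots> \<le> \<gamma> / 2 * r * s"
      using err unfolding r_def s_def by (intro mult_right_mono) auto
    finally show ?thesis
      by simp
  qed
  \<comment> \<open>Young's inequality, weighted so that \<open>s\<^sup>2\<close> cancels exactly;
    what is left of \<open>r\<^sup>2\<close> has the factor
    \<open>1 - 1 / 4 = 3 / 4\<close>.\<close>
  moreover have "\<gamma> / 2 * (r * s) \<le> \<gamma> / 2 * (s\<^sup>2 + r\<^sup>2 / 4)"
  proof (rule mult_left_mono)
    show "r * s \<le> s\<^sup>2 + r\<^sup>2 / 4"
      using zero_le_power2[of "s - r / 2"] by (simp add: power2_diff power_divide mult.commute)
  qed (use \<open>0 \<le> \<gamma>\<close> in simp)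
  moreover have "g \<bullet> (w - x) = g \<bullet> (y - x) + t \<bullet> (w - y) + (g - t) \<bullet> (w - y)"
    by (simp add: inner_diff_left inner_diff_right)
  ultimately have "g \<bullet> (w - x)
      \<le> \<gamma> / 2 * ((norm (x - z))\<^sup>2 - (norm (x - y))\<^sup>2 - (norm (y - z))\<^sup>2)
        + \<gamma> / 2 * ((norm (y - z))\<^sup>2 - r\<^sup>2 - s\<^sup>2) + \<gamma> / 2 * (s\<^sup>2 + r\<^sup>2 / 4)"
    using prox by linarith
  also have "\<dots> = \<gamma> / 2 * ((norm (x - z))\<^sup>2 - (norm (x - y))\<^sup>2 - 3 / 4 * r\<^sup>2)"
    by (simp add: algebra_simps)
  finally show ?thesis
    by (simp add: r_def)
qed

section \<open>A power mean inequality and the telescoped sum\<close>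

lemma powr_minus_ge_tangent:
  fixes t b :: real
  assumes "0 < t" "0 \<le> b"
  shows "1 - b * (t - 1) \<le> t powr - b"
proof -
  have "1 - b * (t - 1) \<le> 1 + - b * ln t"
    using mult_left_mono[OF ln_le_minus_one[OF assms(1)] assms(2)] by simp
  also have "\<dots> \<le> exp (- b * ln t)"
    by (rule exp_ge_add_one_self)
  finally show ?thesis
    using assms by (simp add: powr_def)
qed

text \<open>Jensen's inequality for the convex function \<open>s powr - (a / 2)\<close> of the
  squares \<open>s = (r k)\<^sup>2\<close>, proved by summing tangent bounds at
  \<open>m = S / K\<close>. The function decreases, so an upper bound \<open>S\<close> on the sum of
  squares is enough. For \<open>a = 0\<close> both sides are \<open>K\<close>, even if some
  \<open>r k\<close> is zero.\<close>

lemma sum_inverse_rpow_ge: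
  fixes r :: "nat \<Rightarrow> real"
  assumes "0 \<le> a" and r: "\<And>k. k < K \<Longrightarrow> 0 \<le> r k \<and> rpow (r k) a \<noteq> 0"
    and S: "(\<Sum>k<K. (r k)\<^sup>2) \<le> S" "0 < S" and K: "1 \<le> K"
  shows "real K powr (1 + a / 2) / S powr (a / 2) \<le> (\<Sum>k<K. 1 / rpow (r k) a)"
proof (cases "a = 0")
  case False
  with r have pos: "0 < r k" if "k < K" for k
    using that by (fastforce simp: rpow_def less_le)
  define m where "m = S / K"
  have m: "0 < m"
    using S K by (simp add: m_def)
  have le: "m powr - (a / 2) * (1 - a / 2 * ((r k)\<^sup>2 / m - 1)) \<le> 1 / rpow (r k) a" if "k < K" for k
  proof -
    have "m powr - (a / 2) * (1 - a / 2 * ((r k)\<^sup>2 / m - 1))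
        \<le> m powr - (a / 2) * ((r k)\<^sup>2 / m) powr - (a / 2)"
      using m pos[OF that] \<open>0 \<le> a\<close> by (intro mult_left_mono powr_minus_ge_tangent) auto
    also have "\<dots> = ((r k)\<^sup>2) powr - (a / 2)"
      using m pos[OF that] by (simp flip: powr_mult)
    also have "\<dots> = r k powr - a"
      using pos[OF that] by (simp add: powr_powr flip: powr_numeral)
    finally show ?thesis
      using False by (simp add: rpow_def powr_minus_divide)
  qed
  have "real K powr (1 + a / 2) / S powr (a / 2) = m powr - (a / 2) * K"
    using S K by (simp add: m_def powr_divide powr_minus_divide powr_add)
  \<comment> \<open>The mean of the squares is at most \<open>m\<close>, so the linear part of the
    tangent contributes a nonnegative amount.\<close>
  also have "\<dots> \<le> m powr - (a / 2) * (K - a / 2 * ((\<Sum>k<K. (r k)\<^sup>2) / m - K))"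
  proof (intro mult_left_mono)
    have "(\<Sum>k<K. (r k)\<^sup>2) / m \<le> K"
      using S K m by (simp add: m_def divide_simps mult.commute)
    then show "real K \<le> K - a / 2 * ((\<Sum>k<K. (r k)\<^sup>2) / m - K)"
      using \<open>0 \<le> a\<close> by (simp add: mult_le_0_iff)
  qed simp
  also have "\<dots> = (\<Sum>k<K. m powr - (a / 2) * (1 - a / 2 * ((r k)\<^sup>2 / m - 1)))"
    by (simp add: sum_distrib_left sum_subtractf sum_divide_distrib right_diff_distrib)
  also have "\<dots> \<le> (\<Sum>k<K. 1 / rpow (r k) a)"
    by (intro sum_mono le) simp
  finally show ?thesis .
qed (use S in \<open>simp add: rpow_def\<close>)

lemma monotone_operator_onD:
  assumes "monotone_operator_on Z F" "u \<in> Z" "w \<in> Z"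
  shows "F u \<bullet> (w - u) \<le> F w \<bullet> (w - u)"
  using assms unfolding monotone_operator_on_def by (force simp: inner_diff_left)

lemma weighted_gap_sum:
  fixes z w :: "nat \<Rightarrow> 'a::euclidean_space"
  assumes pos: "\<And>k. k < K \<Longrightarrow> 0 < \<gamma> k"
    and step: "\<And>k. k < K \<Longrightarrow> F (w k) \<bullet> (w k - x)
      \<le> \<gamma> k / 2 * ((norm (x - z k))\<^sup>2 - (norm (x - z (Suc k)))\<^sup>2 - 3 / 4 * (norm (w k - z k))\<^sup>2)"
  shows "(\<Sum>k<K. (1 / \<gamma> k) * (F (w k) \<bullet> (w k - x)))
    \<le> (norm (x - z 0))\<^sup>2 / 2 - 3 / 8 * (\<Sum>k<K. (norm (w k - z k))\<^sup>2)"
proof -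
  have "(\<Sum>k<K. (1 / \<gamma> k) * (F (w k) \<bullet> (w k - x)))
      \<le> (\<Sum>k<K. 1 / 2 * ((norm (x - z k))\<^sup>2 - (norm (x - z (Suc k)))\<^sup>2)
                 - 3 / 8 * (norm (w k - z k))\<^sup>2)"
  proof (rule sum_mono)
    fix k assume "k \<in> {..<K}"
    then show "(1 / \<gamma> k) * (F (w k) \<bullet> (w k - x))
        \<le> 1 / 2 * ((norm (x - z k))\<^sup>2 - (norm (x - z (Suc k)))\<^sup>2) - 3 / 8 * (norm (w k - z k))\<^sup>2"
      using step[of k] pos[of k] by (simp add: field_simps)
  qed
  also have "\<dots> = 1 / 2 * (\<Sum>k<K. (norm (x - z k))\<^sup>2 - (norm (x - z (Suc k)))\<^sup>2)
      - 3 / 8 * (\<Sum>k<K. (norm (w k - z k))\<^sup>2)"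
    by (subst sum_subtractf) (simp only: sum_distrib_left)
  also have "(\<Sum>k<K. (norm (x - z k))\<^sup>2 - (norm (x - z (Suc k)))\<^sup>2)
      = (norm (x - z 0))\<^sup>2 - (norm (x - z K))\<^sup>2"
    by (rule sum_lessThan_telescope')
  also have "1 / 2 * ((norm (x - z 0))\<^sup>2 - (norm (x - z K))\<^sup>2)
        - 3 / 8 * (\<Sum>k<K. (norm (w k - z k))\<^sup>2)
      \<le> (norm (x - z 0))\<^sup>2 / 2 - 3 / 8 * (\<Sum>k<K. (norm (w k - z k))\<^sup>2)"
    by simp
  finally show ?thesis .
qed

section \<open>Runs of the method and the gap of their output\<close>

locale rteg_problem =
  fixes Z :: "'a::euclidean_space set" and F :: "'a \<Rightarrow> 'a"
    and DF :: "'a \<Rightarrow> 'a list \<Rightarrow> 'a"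
    and p :: nat and \<nu> D \<H> :: real and z0 :: 'a
  assumes p: "2 \<le> p" and \<nu>: "0 \<le> \<nu>"
    and Z: "closed Z" "convex Z"
    and mono: "monotone_operator_on Z F"
    and D: "0 < D" "\<forall>z\<in>Z. \<forall>u\<in>Z. norm (z - u) \<le> D"
    and der: "derivatives_on (p - 1) Z F DF"
    and \<H>: "0 \<le> \<H>" and hold: "holder_derivative_on (p - 1) Z DF \<nu> \<H>"
    and z0: "z0 \<in> Z"
begin

abbreviation "run \<equiv> rteg_run p \<nu> \<H> Z F DF z0"
abbreviation "gam \<equiv> rteg_gamma p \<nu> \<H>"
abbreviation "out \<equiv> rteg_output p \<nu> \<H>"

lemma gamma_nonneg: "0 \<le> gam z w k"
  by (simp add: rteg_gamma_def rteg_M_def C_const_nonneg \<nu> \<H> rpow_nonneg)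

lemma rate_const_nonneg: "0 \<le> rate_const p \<nu>"
  by (simp add: rate_const_def C_const_nonneg \<nu>)

lemma run_w_mem: "run K z w \<Longrightarrow> k < K \<Longrightarrow> w k \<in> Z"
  by (simp add: rteg_run_def VI_def)

lemma run_z_mem:
  assumes "run K z w" "k \<le> K"
  shows "z k \<in> Z"
proof (cases k)
  case 0
  with assms z0 show ?thesis by (simp add: rteg_run_def)
next
  case (Suc j)
  with assms show ?thesis by (auto simp: rteg_run_def is_arg_min_def)
qed

text \<open>At \<open>w k\<close> itself the coefficient of the regularizer is exactly
  \<open>gam z w k\<close>, so the oracle's condition takes the form used in
  \<open>extragradient_step\<close>.\<close>

lemma run_model:
  assumes "run K z w" "k < K" "x \<in> Z"
  shows "0 \<le> (taylor_model p DF (z k) (w k) + gam z w k *\<^sub>R (w k - z k)) \<bullet> (x - w k)"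
  using assms by (simp add: rteg_run_def VI_def regularized_model_def rteg_gamma_def)

text \<open>The factor 2 in \<open>rteg_M\<close> makes the Taylor error at most half the size of
  the regularization term.\<close>

lemma run_model_error:
  assumes "run K z w" "k < K"
  shows "norm (F (w k) - taylor_model p DF (z k) (w k)) \<le> gam z w k / 2 * norm (w k - z k)"
  using taylor_model_error[OF p \<nu> Z(2) der hold run_z_mem[OF assms(1), of k] run_w_mem[OF assms]]
    assms(2) by (simp add: rteg_gamma_def rteg_M_def mult_ac)

lemma run_step:
  assumes run: "run K z w" and k: "k < K" and pos: "0 < gam z w k" and x: "x \<in> Z"
  shows "F (w k) \<bullet> (w k - x) \<le> gam z w k / 2 *
    ((norm (x - z k))\<^sup>2 - (norm (x - z (Suc k)))\<^sup>2 - 3 / 4 * (norm (w k - z k))\<^sup>2)"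
proof (rule extragradient_step)
  show "F (w k) \<bullet> (z (Suc k) - x) \<le> gam z w k / 2 *
      ((norm (x - z k))\<^sup>2 - (norm (x - z (Suc k)))\<^sup>2 - (norm (z (Suc k) - z k))\<^sup>2)"
    by (rule prox_step[OF Z(2,1) pos _ x]) (use run k in \<open>simp add: rteg_run_def\<close>)
  show "0 \<le> (taylor_model p DF (z k) (w k) + gam z w k *\<^sub>R (w k - z k)) \<bullet> (z (Suc k) - w k)"
    by (rule run_model[OF run k]) (use run_z_mem[OF run] k in simp)
qed (use pos run_model_error[OF run k] in simp_all)

text \<open>If \<open>gam z w k = 0\<close>, the error bound forces the model to be exact at
  \<open>w k\<close>, so \<open>w k\<close> solves the variational inequality of \<open>F\<close>
  itself. Monotonicity moves the operator from \<open>w k\<close> to \<open>x\<close>.\<close>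

lemma gap_stationary:
  assumes run: "run K z w" and k: "k < K" and zero: "gam z w k = 0" and x: "x \<in> Z"
  shows "F x \<bullet> (w k - x) \<le> 0"
proof -
  have "F (w k) = taylor_model p DF (z k) (w k)"
    using run_model_error[OF run k] zero by simp
  then have "F (w k) \<bullet> (w k - x) \<le> 0"
    using run_model[OF run k x] zero by (simp add: inner_diff_right)
  then show ?thesis
    using monotone_operator_onD[OF mono x run_w_mem[OF run k]] by linarith
qed

lemma gap_positive:
  assumes run: "run K z w" and K: "1 \<le> K" and pos: "\<And>k. k < K \<Longrightarrow> 0 < gam z w k"
    and x: "x \<in> Z"
  shows "F x \<bullet> ((1 / (\<Sum>k<K. 1 / gam z w k)) *\<^sub>R (\<Sum>k<K. (1 / gam z w k) *\<^sub>R w k) - x)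
    \<le> rate_const p \<nu> * (\<H> * D powr (real p + \<nu>) / real K powr ((real p + \<nu>) / 2))"
    (is "?G \<le> ?R")
proof (cases "?G \<le> 0")
  case True
  moreover have "0 \<le> ?R"
    by (intro mult_nonneg_nonneg divide_nonneg_nonneg rate_const_nonneg \<H>) auto
  ultimately show ?thesis
    by linarith
next
  \<comment> \<open>A positive gap at \<open>x\<close> already forces \<open>(\<Sum>k<K. (norm (w k - z k))\<^sup>2) \<le> 4 / 3 * D\<^sup>2\<close>, so the
    existence of a solution of the variational inequality is not needed.\<close>
  case False
  define \<Lambda> where "\<Lambda> = (\<Sum>k<K. 1 / gam z w k)"
  have \<Lambda>: "0 < \<Lambda>"
    unfolding \<Lambda>_def using K pos by (intro sum_pos) (auto simp: lessThan_empty_iff)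
  have "\<Lambda> * ?G = (\<Sum>k<K. (1 / gam z w k) * (F x \<bullet> (w k - x)))"
  proof -
    have "\<Lambda> * ?G = F x \<bullet> (\<Sum>k<K. (1 / gam z w k) *\<^sub>R w k) - \<Lambda> * (F x \<bullet> x)"
      using \<Lambda> by (simp add: inner_diff_right right_diff_distrib flip: \<Lambda>_def)
    then show ?thesis
      by (simp add: \<Lambda>_def inner_sum_right inner_diff_right right_diff_distrib sum_subtractf
          sum_distrib_right diff_divide_distrib)
  qed
  also have "\<dots> \<le> (\<Sum>k<K. (1 / gam z w k) * (F (w k) \<bullet> (w k - x)))"
    by (intro sum_mono mult_left_mono monotone_operator_onD[OF mono x] run_w_mem[OF run])
      (auto simp: gamma_nonneg)
  also have "\<dots> \<le> (norm (x - z 0))\<^sup>2 / 2 - 3 / 8 * (\<Sum>k<K. (norm (w k - z k))\<^sup>2)"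
    by (intro weighted_gap_sum run_step[OF run] pos x)
  also have "\<dots> \<le> D\<^sup>2 / 2 - 3 / 8 * (\<Sum>k<K. (norm (w k - z k))\<^sup>2)"
    using D(2) x run_z_mem[OF run, of 0] by (simp add: power_mono)
  finally have main: "\<Lambda> * ?G \<le> D\<^sup>2 / 2 - 3 / 8 * (\<Sum>k<K. (norm (w k - z k))\<^sup>2)" .
  \<comment> \<open>With this \<open>a\<close> the target exponent \<open>(p + \<nu>) / 2\<close> is
    \<open>1 + a / 2\<close>, the one in \<open>sum_inverse_rpow_ge\<close>.\<close>
  define a where "a = real p - 2 + \<nu>"
  define M where "M = rteg_M p \<nu> \<H>"
  define S where "S = 4 / 3 * D\<^sup>2"
  have a: "0 \<le> a" "(real p + \<nu>) / 2 = 1 + a / 2" "real p + \<nu> = 2 + a"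
    using p \<nu> by (auto simp: a_def field_simps)
  have S: "0 < S"
    using D by (simp add: S_def)
  have gam_eq: "gam z w k = M * rpow (norm (w k - z k)) a" for k
    by (simp add: rteg_gamma_def M_def a_def)
  \<comment> \<open>With \<open>K \<ge> 1\<close> there is a step 0, and its \<open>gam\<close>
    would vanish if \<open>M\<close> were zero.\<close>
  have "0 < M"
    using pos[of 0] K rpow_nonneg[of "norm (w 0 - z 0)" a]
    unfolding gam_eq by (simp add: zero_less_mult_iff)
  have "0 < \<Lambda> * ?G"
    using \<Lambda> False by simp
  then have "(\<Sum>k<K. (norm (w k - z k))\<^sup>2) \<le> S"
    using main by (simp add: S_def)
  then have "real K powr (1 + a / 2) / S powr (a / 2) \<le> (\<Sum>k<K. 1 / rpow (norm (w k - z k)) a)"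
    using pos S K a(1) by (intro sum_inverse_rpow_ge) (force simp: gam_eq)+
  also have "\<dots> = M * \<Lambda>"
    using \<open>0 < M\<close> by (simp add: \<Lambda>_def gam_eq sum_distrib_left)
  \<comment> \<open>The lower bound on \<open>M * \<Lambda>\<close> meets the upper bound
    \<open>D\<^sup>2 / 2\<close> on \<open>\<Lambda> * ?G\<close>. The resulting
    \<open>M / 2\<close> is \<open>C_const p \<nu> * \<H>\<close>, and the power of
    \<open>4 / 3\<close> in \<open>rate_const\<close> comes from \<open>S\<close>.\<close>
  finally have "real K powr (1 + a / 2) / S powr (a / 2) * ?G \<le> M * \<Lambda> * ?G"
    using False by (intro mult_right_mono) auto
  also have "\<dots> \<le> M * (D\<^sup>2 / 2)"
    using main \<open>0 < M\<close> sum_nonneg[of "{..<K}" "\<lambda>k. (norm (w k - z k))\<^sup>2"] by simp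
  finally have "?G \<le> M * (D\<^sup>2 / 2) * (S powr (a / 2) / real K powr (1 + a / 2))"
    using K S by (simp add: field_simps)
  also have "S powr (a / 2) = (4 / 3) powr (a / 2) * D powr a"
    unfolding S_def using D(1) by (subst powr_mult) (simp_all add: powr_powr flip: powr_numeral)
  also have "M * (D\<^sup>2 / 2) * ((4 / 3) powr (a / 2) * D powr a / real K powr (1 + a / 2)) = ?R"
    using D(1) unfolding rate_const_def a(2) unfolding a(3) a_def[symmetric]
    by (simp add: M_def rteg_M_def powr_add)
  finally show ?thesis .
qed

lemma output_gap_le:
  assumes run: "run K z w" and K: "1 \<le> K" and x: "x \<in> Z"
  shows "F x \<bullet> (out K z w - x)
    \<le> rate_const p \<nu> * (\<H> * D powr (real p + \<nu>) / real K powr ((real p + \<nu>) / 2))"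
proof (cases "\<exists>k<K. gam z w k = 0")
  case True
  \<comment> \<open>\<open>LEAST\<close> ranges over all naturals; a zero below \<open>K\<close>
    ensures that it picks an actual iteration of the run.\<close>
  then have "(LEAST k. gam z w k = 0) < K" "gam z w (LEAST k. gam z w k = 0) = 0"
    by (auto intro: LeastI Least_le[THEN le_less_trans])
  then have "F x \<bullet> (out K z w - x) \<le> 0"
    using gap_stationary[OF run _ _ x] True by (simp add: rteg_output_def Let_def)
  also have "0 \<le> rate_const p \<nu> * (\<H> * D powr (real p + \<nu>) / real K powr ((real p + \<nu>) / 2))"
    by (intro mult_nonneg_nonneg divide_nonneg_nonneg rate_const_nonneg \<H>) auto
  finally show ?thesis .
next
  case False
  then have "0 < gam z w k" if "k < K" for k
    using that gamma_nonneg[of z w k] by (auto simp: less_le)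
  from gap_positive[OF run K this x] False show ?thesis
    by (auto simp: rteg_output_def Let_def)
qed

lemma weak_gap_output_le:
  assumes "run K z w" "1 \<le> K"
  shows "weak_gap F Z (out K z w)
    \<le> rate_const p \<nu> * (\<H> * D powr (real p + \<nu>) / real K powr ((real p + \<nu>) / 2))"
  \<comment> \<open>The pointwise bound is uniform in \<open>x\<close>, and \<open>z0\<close> makes
    the index set of the supremum nonempty.\<close>
  unfolding weak_gap_def using z0 by (intro cSUP_least output_gap_le assms) auto

lemma output_mem:
  assumes run: "run K z w" and K: "1 \<le> K"
  shows "out K z w \<in> Z"
proof (cases "\<exists>k<K. gam z w k = 0")
  case True
  then have "(LEAST k. gam z w k = 0) < K"
    by (auto intro: Least_le[THEN le_less_trans])
  then show ?thesis
    using run_w_mem[OF run] True by (simp add: rteg_output_def Let_def)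
next
  case False
  define \<Lambda> where "\<Lambda> = (\<Sum>k<K. 1 / gam z w k)"
  have "0 < gam z w k" if "k < K" for k
    using that False gamma_nonneg[of z w k] by (auto simp: less_le)
  then have \<Lambda>: "0 < \<Lambda>"
    unfolding \<Lambda>_def using K by (intro sum_pos) (auto simp: lessThan_empty_iff)
  then have "(\<Sum>k<K. 1 / gam z w k / \<Lambda>) = 1"
    unfolding sum_divide_distrib[symmetric] by (simp flip: \<Lambda>_def)
  then have "(\<Sum>k<K. (1 / gam z w k / \<Lambda>) *\<^sub>R w k) \<in> Z"
    using \<Lambda> by (intro convex_sum Z run_w_mem[OF run] divide_nonneg_nonneg gamma_nonneg) auto
  also have "(\<Sum>k<K. (1 / gam z w k / \<Lambda>) *\<^sub>R w k) = out K z w"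
    using False
    by (auto simp: rteg_output_def Let_def scaleR_sum_right mult.commute simp flip: \<Lambda>_def)
  finally show ?thesis .
qed

section \<open>From the rate to the number of oracle calls\<close>

lemma rate_le_if_calls_le:
  assumes \<epsilon>: "0 < \<epsilon>" and K: "1 \<le> K"
    and le: "calls_const p \<nu> * (\<H> powr (2 / (real p + \<nu>)) * D\<^sup>2 * \<epsilon> powr (- 2 / (real p + \<nu>)))
      \<le> real K"
  shows "rate_const p \<nu> * (\<H> * D powr (real p + \<nu>) / real K powr ((real p + \<nu>) / 2)) \<le> \<epsilon>"
proof -
  define q where "q = real p + \<nu>"
  have q: "0 < q"
    using p \<nu> by (simp add: q_def)
  \<comment> \<open>Chosen so that \<open>\<epsilon> * X powr (q / 2)\<close> equals the numerator
    of the rate bound; raising \<open>X \<le> K\<close> to the power \<open>q / 2\<close> then gives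
    the claim.\<close>
  define X where "X = rate_const p \<nu> powr (2 / q) * (\<H> powr (2 / q) * D\<^sup>2 * \<epsilon> powr (- 2 / q))"
  have "X powr (q / 2) = rate_const p \<nu> * (\<H> * D powr q * \<epsilon> powr - 1)"
    unfolding X_def using q \<H> rate_const_nonneg D(1) \<epsilon>
    by (simp add: powr_mult powr_powr flip: powr_numeral)
  moreover have "\<epsilon> * X powr (q / 2) \<le> \<epsilon> * real K powr (q / 2)"
    using le q \<epsilon> by (intro mult_left_mono powr_mono2)
      (auto simp: X_def q_def calls_const_def rate_const_nonneg)
  ultimately have "rate_const p \<nu> * (\<H> * D powr q) \<le> \<epsilon> * real K powr (q / 2)"
    using \<epsilon> by (simp add: powr_minus field_simps)
  then show ?thesis
    unfolding q_def[symmetric] using K by (simp add: field_simps)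
qed

lemma calls_suffice:
  assumes "0 < \<epsilon>"
  shows "\<exists>K\<ge>1. int K \<le> max 1 \<lceil>calls_const p \<nu> *
      (\<H> powr (2 / (real p + \<nu>)) * D\<^sup>2 * \<epsilon> powr (- 2 / (real p + \<nu>)))\<rceil> \<and>
    (\<forall>z w. run K z w \<longrightarrow> weak_solution \<epsilon> F Z (out K z w))"
proof -
  define X where "X = calls_const p \<nu> *
    (\<H> powr (2 / (real p + \<nu>)) * D\<^sup>2 * \<epsilon> powr (- 2 / (real p + \<nu>)))"
  \<comment> \<open>One \<open>K\<close> serves all runs. The maximum with 1 covers
    \<open>X = 0\<close>, which occurs for \<open>\<H> = 0\<close>: an output takes at least one
    iteration.\<close>
  define K where "K = nat (max 1 \<lceil>X\<rceil>)"
  have K: "1 \<le> K" "int K = max 1 \<lceil>X\<rceil>" "X \<le> real K"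
    unfolding K_def by linarith+
  have "weak_solution \<epsilon> F Z (out K z w)" if "run K z w" for z w
    unfolding weak_solution_def
    using output_mem[OF that K(1)] weak_gap_output_le[OF that K(1)]
      rate_le_if_calls_le[OF assms K(1) K(3)[unfolded X_def]] by linarith
  with K show ?thesis
    unfolding X_def by (intro exI[of _ K]) auto
qed

end

theorem theorem3p1:
  fixes Z :: "'a::euclidean_space set" and F :: "'a \<Rightarrow> 'a"
    and DF :: "'a \<Rightarrow> 'a list \<Rightarrow> 'a"
    and p :: nat and \<nu> D \<H> :: real and z0 :: 'a
  assumes "2 \<le> p" and "0 \<le> \<nu>" and "\<nu> \<le> 1"
    and "closed Z" and "convex Z"
    and "monotone_operator_on Z F"
    and "0 < D" and "\<forall>z\<in>Z. \<forall>u\<in>Z. norm (z - u) \<le> D"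
    and "derivatives_on (p - 1) Z F DF"
    and "0 \<le> \<H>" and "holder_derivative_on (p - 1) Z DF \<nu> \<H>"
    and "z0 \<in> Z"
  shows "(\<forall>K\<ge>1. \<forall>z w. rteg_run p \<nu> \<H> Z F DF z0 K z w \<longrightarrow>
            weak_gap F Z (rteg_output p \<nu> \<H> K z w)
              \<le> rate_const p \<nu> * (\<H> * D powr (real p + \<nu>) / real K powr ((real p + \<nu>) / 2)))
       \<and> (\<forall>\<epsilon>>0. \<exists>K\<ge>1.
            int K \<le> max 1 \<lceil>calls_const p \<nu> *
              (\<H> powr (2 / (real p + \<nu>)) * D\<^sup>2 * \<epsilon> powr (- 2 / (real p + \<nu>)))\<rceil> \<and>
            (\<forall>z w. rteg_run p \<nu> \<H> Z F DF z0 K z w \<longrightarrow>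
               weak_solution \<epsilon> F Z (rteg_output p \<nu> \<H> K z w)))"
proof -
  interpret rteg_problem Z F DF p \<nu> D \<H> z0
    by unfold_locales (fact assms)+
  show ?thesis
    using weak_gap_output_le calls_suffice by blast
qed

end
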